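(* Let $L, N, \mathcal{T} \ge 1$ be integers, let $\epsilon>0$, and let $K_{\ell i k} = \exp(-C_{\ell i k}/\epsilon)$ for $\ell\in\{1,\dots,L\}$, $i,k\in\{1,\dots,N\}$, where $C_{\ell i k}$ is the cost of moving a unit mass of species $\ell$ from $x_i$ to $x_k$ in one time step (defined in the context). Let $U_{-1,0}, U_{-1,1},\dots,U_{-1,\mathcal{T}} \in \mathbb{R}^{L\times N}$ be matrices and $u_1,\dots,u_{\mathcal{T}}\in\mathbb{R}^N$ be vectors. Define the $(\mathcal{T}+2)$-mode tensors $\mathbf{K},\mathbf{U}\in\mathbb{R}^{L\times N^{\mathcal{T}+1}}$ by $$\mathbf{K}_{\ell i_0\dots i_{\mathcal{T}}} = \prod_{j=0}^{\mathcal{T}-1} K_{\ell i_j i_{j+1}},\qquad \mathbf{U}_{\ell i_0\dots i_{\mathcal{T}}} = (U_{-1,0})_{\ell i_0}\left(\prod_{j=1}^{\mathcal{T}} (U_{-1,j})_{\ell i_j}\right)\left(\prod_{j=1}^{\mathcal{T}} (u_j)_{i_j}\right).$$ For $A\in\mathbb{R}^{L\times N}$ define $\hat S_K(A), S_K(A)\in\mathbb{R}^{L\times N}$ by $$(\hat S_K(A))_{i_1 i_3} = \sum_{i_2=1}^N K_{i_1 i_2 i_3} A_{i_1 i_2},\qquad (S_K(A))_{i_1 i_2} = \sum_{i_3=1}^N K_{i_1 i_2 i_3} A_{i_1 i_3},$$ where the first index $i_1$ ranges over $\{1,\dots,L\}$ and the indices $i_2,i_3$ range over $\{1,\dots,N\}$.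 Define matrices in $\mathbb{R}^{L\times N}$ recursively by $$\hat\Psi_j = \begin{cases}\hat S_K(U_{-1,0}), & j=1,\\ \hat S_K\big(\hat\Psi_{j-1}\odot U_{-1,j-1}\,\mathrm{diag}(u_{j-1})\big), & j=2,\dots,\mathcal{T},\end{cases}$$ $$\Psi_j = \begin{cases} S_K\big(U_{-1,\mathcal{T}}\,\mathrm{diag}(u_{\mathcal{T}})\big), & j=\mathcal{T}-1,\\ S_K\big(\Psi_{j+1}\odot U_{-1,j+1}\,\mathrm{diag}(u_{j+1})\big), & j=0,\dots,\mathcal{T}-2.\end{cases}$$ Then the bi-marginal projections of the tensor $\mathbf{M}=\mathbf{K}\odot\mathbf{U}$ on the marginals $-1$ and $j$ are given by $$P_{-1,j}(\mathbf{K}\odot\mathbf{U}) = \Psi_j\odot\hat\Psi_j\odot U_{-1,j}\,\mathrm{diag}(u_j)\qquad\text{for } j=1,\dots,\mathcal{T}-1,$$ and $$P_{-1,0}(\mathbf{K}\odot\mathbf{U}) = \Psi_0\odot U_{-1,0},\qquad P_{-1,\mathcal{T}}(\mathbf{K}\odot\mathbf{U}) = \hat\Psi_{\mathcal{T}}\odot U_{-1,\mathcal{T}}\,\mathrm{diag}(u_{\mathcal{T}}).$$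
   Context: Notation: $\odot$ denotes the elementwise (Hadamard) product of arrays of equal size, and $\mathrm{diag}(u)$ is the diagonal matrix with the vector $u$ on its diagonal; the matrix product with $\mathrm{diag}(u)$ has precedence (equivalently, $A\odot B\,\mathrm{diag}(u)$ has entries $A_{\ell i}B_{\ell i}u_i$). Tensors $\mathbf{M}\in\mathbb{R}^{L\times N^{\mathcal{T}+1}}$ have modes numbered $-1,0,1,\dots,\mathcal{T}$: mode $-1$ is indexed by the species $\ell\in\{1,\dots,L\}$, and mode $j\in\{0,\dots,\mathcal{T}\}$ (time $j\Delta t$, $\Delta t = 1/\mathcal{T}$) is indexed by $i_j\in\{1,\dots,N\}$. The bi-marginal projection of $\mathbf{M}$ on the modes $-1$ and $j$ is the matrix $P_{-1,j}(\mathbf{M})\in\mathbb{R}^{L\times N}$ given by $$(P_{-1,j}(\mathbf{M}))_{\ell i_j} = \sum_{i_0,\dots,i_{j-1},i_{j+1},\dots,i_{\mathcal{T}}}\mathbf{M}_{\ell i_0\dots i_{\mathcal{T}}},$$ each summation index ranging over $\{1,\dots,N\}$. Costs: $x_1,\dots,x_N$ are discretization points in a state space $X\subset\mathbb{R}^n$; for each species $\ell$, $f_\ell:X\to\mathbb{R}^n$ and $B_\ell:X\to\mathbb{R}^{n\times n}$ are continuously differentiable with bounded derivatives. $C_{\ell i k}\in[0,\infty]$ is the optimal value of minimizing $\int_0^{\Delta t}\frac12\|v\|^2\,dt$ over $v\in L_2([0,\Delta t])$ subject to $\dot x = f_\ell(x)+B_\ell(x)v$, $x(0)=x_i$, $x(\Delta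 t)=x_k$, with value $\infty$ if the transition is not possible; the convention $\exp(-\infty)=0$ is used, so that $K_{\ell i k}\in[0,1]$. *)

theory Defs
  imports "HOL-Analysis.Analysis"
begin

text \<open>Species are indexed by a finite type \<open>'l\<close>, discretization points by a finite type \<open>'n\<close>,
  and the state space is a subset of \<open>real ^ 'd\<close>.\<close>

text \<open>For arbitrary \<open>X\<close> the derivative is taken within \<open>X\<close>; on open sets this is the usual one.
  Continuity and boundedness of the derivative are with respect to the operator norm.\<close>

definition C1_bounded_deriv_on ::
  "'a::real_normed_vector set \<Rightarrow> ('a \<Rightarrow> 'b::real_normed_vector) \<Rightarrow> bool" where
  "C1_bounded_deriv_on X g \<longleftrightarrow>
     (\<exists>g' :: 'a \<Rightarrow> 'a \<Rightarrow>\<^sub>L 'b.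
        (\<forall>x\<in>X. (g has_derivative blinfun_apply (g' x)) (at x within X)) \<and>
        continuous_on X g' \<and> bounded (g' ` X))"

definition L2_control :: "real \<Rightarrow> (real \<Rightarrow> real ^ 'd) \<Rightarrow> bool" where
  "L2_control h v \<longleftrightarrow>
     v \<in> borel_measurable (lebesgue_on {0..h}) \<and>
     integrable (lebesgue_on {0..h}) (\<lambda>t. (norm (v t))\<^sup>2)"

text \<open>As the controls are only square integrable, the differential equation
  \<open>\<xi>' = f(\<xi>) + B(\<xi>) v\<close> is understood in the sense of Caratheodory, i.e. through the equivalent
  integral equation. The trajectory has to stay in \<open>X\<close>, where \<open>f\<close> and \<open>B\<close> are given.\<close>

definition trajectory ::
  "(real ^ 'd) set \<Rightarrow> (real ^ 'd \<Rightarrow> real ^ 'd) \<Rightarrow> (real ^ 'd \<Rightarrow> real ^ 'd ^ 'd) \<Rightarrow> real \<Rightarrow>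
   (real \<Rightarrow> real ^ 'd) \<Rightarrow> (real \<Rightarrow> real ^ 'd) \<Rightarrow> bool" where
  "trajectory X f B h v \<xi> \<longleftrightarrow>
     (\<forall>t\<in>{0..h}. \<xi> t \<in> X) \<and>
     (\<lambda>s. f (\<xi> s) + B (\<xi> s) *v v s) absolutely_integrable_on {0..h} \<and>
     (\<forall>t\<in>{0..h}. \<xi> t = \<xi> 0 + integral {0..t} (\<lambda>s. f (\<xi> s) + B (\<xi> s) *v v s))"

text \<open>The infimum of the empty set is \<open>\<infinity>\<close>, the value for impossible transitions.\<close>

definition transition_cost ::
  "(real ^ 'd) set \<Rightarrow> (real ^ 'd \<Rightarrow> real ^ 'd) \<Rightarrow> (real ^ 'd \<Rightarrow> real ^ 'd ^ 'd) \<Rightarrow> real \<Rightarrow>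
   real ^ 'd \<Rightarrow> real ^ 'd \<Rightarrow> ennreal" where
  "transition_cost X f B h a b =
     Inf {ennreal (\<integral>t. 1 / 2 * (norm (v t))\<^sup>2 \<partial>lebesgue_on {0..h}) | v.
       L2_control h v \<and> (\<exists>\<xi>. trajectory X f B h v \<xi> \<and> \<xi> 0 = a \<and> \<xi> h = b)}"

text \<open>\<open>exp (- c)\<close> with the convention \<open>exp (- \<infinity>) = 0\<close>\<close>

definition exp_neg :: "ennreal \<Rightarrow> real" where
  "exp_neg c = (if c = \<infinity> then 0 else exp (- enn2real c))"

text \<open>The library's multiplication on \<open>real ^ 'n ^ 'l\<close> is entrywise. The priority is just
  below that of the matrix product \<open>**\<close>.\<close>

abbreviation hadamard ::
  "real ^ 'n::finite ^ 'l::finite \<Rightarrow> real ^ 'n ^ 'l \<Rightarrow> real ^ 'n ^ 'l" (infixl "\<odot>" 69) where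
  "A \<odot> B \<equiv> A * B"

definition diag :: "real ^ 'n \<Rightarrow> real ^ 'n ^ 'n" where
  "diag u = (\<chi> i k. if i = k then u $ i else 0)"

text \<open>In the following, \<open>U j\<close> stands for \<open>U\<^bsub>-1,j\<^esub>\<close>.\<close>

definition S_op_hat :: "real ^ 'n ^ 'n ^ 'l \<Rightarrow> real ^ 'n ^ 'l \<Rightarrow> real ^ 'n ^ 'l" where
  "S_op_hat K A = (\<chi> l k. \<Sum>i\<in>UNIV. K $ l $ i $ k * A $ l $ i)"

definition S_op :: "real ^ 'n ^ 'n ^ 'l \<Rightarrow> real ^ 'n ^ 'l \<Rightarrow> real ^ 'n ^ 'l" where
  "S_op K A = (\<chi> l i. \<Sum>k\<in>UNIV. K $ l $ i $ k * A $ l $ k)"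

text \<open>\<open>Psi_hat K U u j\<close> is only meaningful for \<open>j \<ge> 1\<close>, and \<open>Psi T K U u j\<close> for \<open>j < T\<close>.\<close>

fun Psi_hat ::
  "real ^ 'n ^ 'n ^ 'l \<Rightarrow> (nat \<Rightarrow> real ^ 'n ^ 'l) \<Rightarrow> (nat \<Rightarrow> real ^ 'n) \<Rightarrow> nat \<Rightarrow> real ^ 'n ^ 'l" where
  "Psi_hat K U u 0 = undefined"
| "Psi_hat K U u (Suc 0) = S_op_hat K (U 0)"
| "Psi_hat K U u (Suc (Suc j)) =
     S_op_hat K (Psi_hat K U u (Suc j) \<odot> U (Suc j) ** diag (u (Suc j)))"

function Psi ::
  "nat \<Rightarrow> real ^ 'n ^ 'n ^ 'l \<Rightarrow> (nat \<Rightarrow> real ^ 'n ^ 'l) \<Rightarrow> (nat \<Rightarrow> real ^ 'n) \<Rightarrow> nat \<Rightarrow>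
   real ^ 'n ^ 'l" where
  "Psi T K U u j =
     (if j + 1 = T then S_op K (U T ** diag (u T))
      else if j + 1 < T then S_op K (Psi T K U u (j + 1) \<odot> U (j + 1) ** diag (u (j + 1)))
      else undefined)"
  by auto
termination
  by (relation "Wellfounded.measure (\<lambda>(T, K, U, u, j). T - j)") auto

declare Psi.simps [simp del]

text \<open>A tensor with modes \<open>-1, 0, \<dots>, T\<close> is a function of the species and of a multi-index
  in \<open>{0..T} \<rightarrow>\<^sub>E UNIV\<close>.\<close>

type_synonym ('l, 'n) tensor = "'l \<Rightarrow> (nat \<Rightarrow> 'n) \<Rightarrow> real"

definition tensor_hadamard ::
  "('l, 'n) tensor \<Rightarrow> ('l, 'n) tensor \<Rightarrow> ('l, 'n) tensor" (infixl "\<odot>\<^sub>T" 69) where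
  "M \<odot>\<^sub>T M' = (\<lambda>l i. M l i * M' l i)"

definition K_tensor :: "nat \<Rightarrow> real ^ 'n ^ 'n ^ 'l \<Rightarrow> ('l, 'n) tensor" where
  "K_tensor T K = (\<lambda>l i. \<Prod>j<T. K $ l $ i j $ i (j + 1))"

definition U_tensor ::
  "nat \<Rightarrow> (nat \<Rightarrow> real ^ 'n ^ 'l) \<Rightarrow> (nat \<Rightarrow> real ^ 'n) \<Rightarrow> ('l, 'n) tensor" where
  "U_tensor T U u =
     (\<lambda>l i. U 0 $ l $ i 0 * (\<Prod>j=1..T. U j $ l $ i j) * (\<Prod>j=1..T. u j $ i j))"

text \<open>The projection on the modes \<open>-1\<close> and \<open>j\<close>: \<open>i\<close> runs over the indices of the remaining modes.\<close>

definition bimarginal :: "nat \<Rightarrow> nat \<Rightarrow> ('l, 'n) tensor \<Rightarrow> real ^ 'n ^ 'l" where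
  "bimarginal T j M =
     (\<chi> l k. \<Sum>i\<in>({0..T} - {j}) \<rightarrow>\<^sub>E UNIV. M l (i(j := k)))"

end

theory Submission
  imports Defs
begin

text \<open>For a fixed species \<open>l\<close>, the entry of the tensor at a multi-index \<open>i\<close> is the weight of the path
  \<open>i 0, \<dots>, i T\<close> in a chain: a factor \<open>K l (i m) (i (m + 1))\<close> for every step and a factor for every
  node, namely \<open>U m l (i m) * u m (i m)\<close>, where \<open>u 0\<close> is taken to be \<open>1\<close>. The bi-marginal is the
  total weight of the paths that visit \<open>k\<close> at time \<open>j\<close>. Fixing the node at time \<open>j\<close> cuts such a
  path into a past and a future that can be chosen independently, and the weight is the product of
  the weight of the past, that of the node \<open>k\<close> and that of the future. By distributivity the sum
  over all paths is the product of a forward sum, the node weight and a backward sum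
  (\<open>chain_marginal\<close>).

  Summing over the node next to the cut turns the forward and the backward sums into one-step
  recursions (\<open>forward_sum_Suc\<close>, \<open>backward_sum_step\<close>). These are the recursions of \<open>Psi_hat\<close> and
  \<open>Psi\<close>, up to the place where they start: the sums start from the empty past at time \<open>0\<close> and the
  empty future at time \<open>T\<close>, both with sum \<open>1\<close>. This is why \<open>Psi_hat\<close> is missing in the projection
  at \<open>0\<close> and \<open>Psi\<close> in the projection at \<open>T\<close>.\<close>

section \<open>Sums over families of indices\<close>

lemma sum_PiE_insert:
  assumes "a \<notin> A"
  shows "(\<Sum>i\<in>insert a A \<rightarrow>\<^sub>E S. h i) = (\<Sum>k\<in>S. \<Sum>i\<in>A \<rightarrow>\<^sub>E S. h (i(a := k)))"
proof -
  have "(\<Sum>i\<in>insert a A \<rightarrow>\<^sub>E S. h i) = (\<Sum>(k, i)\<in>S \<times> (A \<rightarrow>\<^sub>E S). h (i(a := k)))"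
    unfolding PiE_insert_eq
    using inj_combinator[OF assms, of "\<lambda>_. S"]
    by (subst sum.reindex) (auto simp: case_prod_unfold)
  then show ?thesis
    by (simp add: sum.cartesian_product)
qed

text \<open>A family on a disjoint union is a pair of independent families, and a product of a function
  of each distributes over the sum. The locality of \<open>f\<close> and \<open>g\<close> is expressed by the invariance
  under changes outside of \<open>A\<close> and \<open>B\<close>.\<close>

lemma sum_PiE_Un_mult:
  fixes f g :: "('a \<Rightarrow> 'b) \<Rightarrow> 'c::semiring_0"
  assumes disj: "A \<inter> B = {}"
    and f: "\<And>i i'. (\<And>a. a \<in> A \<Longrightarrow> i a = i' a) \<Longrightarrow> f i = f i'"
    and g: "\<And>i i'. (\<And>b. b \<in> B \<Longrightarrow> i b = i' b) \<Longrightarrow> g i = g i'"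
  shows "(\<Sum>i\<in>(A \<union> B) \<rightarrow>\<^sub>E S. f i * g i) = (\<Sum>i\<in>A \<rightarrow>\<^sub>E S. f i) * (\<Sum>i\<in>B \<rightarrow>\<^sub>E S. g i)"
proof -
  have "(\<Sum>i\<in>(A \<union> B) \<rightarrow>\<^sub>E S. f i * g i) = (\<Sum>(i, i')\<in>(A \<rightarrow>\<^sub>E S) \<times> (B \<rightarrow>\<^sub>E S). f i * g i')"
  proof (rule sum.reindex_bij_witness
      [where j = "\<lambda>i. (restrict i A, restrict i B)" and i = "merge A B"], goal_cases)
    case (1 i)
    then show ?case
      by (auto simp: merge_def PiE_def extensional_def fun_eq_iff)
  next
    case (2 i)
    then show ?case by auto
  next
    case (3 p)
    then show ?case
      using disj by (auto simp: PiE_def merge_def extensional_def restrict_def fun_eq_iff)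
  next
    case (4 p)
    then show ?case
      by (auto simp: merge_def PiE_def extensional_def Pi_iff split: if_splits)
  next
    case (5 i)
    then show ?case
      using f[of i "restrict i A"] g[of i "restrict i B"] by simp
  qed
  then show ?thesis
    by (simp add: sum_product sum.cartesian_product)
qed

section \<open>Path sums in a chain\<close>

text \<open>In the following, \<open>\<kappa>\<close> gives the weights of the steps and \<open>w m\<close> the weights of the nodes at
  time \<open>m\<close>. The weight of a past contains the node weights before time \<open>j\<close>, that of a future the
  ones after time \<open>j\<close>, so that neither counts the node at the cut.\<close>

definition past_weight ::
  "('n \<Rightarrow> 'n \<Rightarrow> real) \<Rightarrow> (nat \<Rightarrow> 'n \<Rightarrow> real) \<Rightarrow> nat \<Rightarrow> (nat \<Rightarrow> 'n) \<Rightarrow> real" where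
  "past_weight \<kappa> w j i = (\<Prod>m<j. w m (i m) * \<kappa> (i m) (i (Suc m)))"

definition future_weight ::
  "nat \<Rightarrow> ('n \<Rightarrow> 'n \<Rightarrow> real) \<Rightarrow> (nat \<Rightarrow> 'n \<Rightarrow> real) \<Rightarrow> nat \<Rightarrow> (nat \<Rightarrow> 'n) \<Rightarrow> real" where
  "future_weight T \<kappa> w j i = (\<Prod>m=j..<T. \<kappa> (i m) (i (Suc m)) * w (Suc m) (i (Suc m)))"

definition forward_sum ::
  "('n \<Rightarrow> 'n \<Rightarrow> real) \<Rightarrow> (nat \<Rightarrow> 'n \<Rightarrow> real) \<Rightarrow> nat \<Rightarrow> 'n \<Rightarrow> real" where
  "forward_sum \<kappa> w j k = (\<Sum>i\<in>{..<j} \<rightarrow>\<^sub>E UNIV. past_weight \<kappa> w j (i(j := k)))"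

definition backward_sum ::
  "nat \<Rightarrow> ('n \<Rightarrow> 'n \<Rightarrow> real) \<Rightarrow> (nat \<Rightarrow> 'n \<Rightarrow> real) \<Rightarrow> nat \<Rightarrow> 'n \<Rightarrow> real" where
  "backward_sum T \<kappa> w j k = (\<Sum>i\<in>{j<..T} \<rightarrow>\<^sub>E UNIV. future_weight T \<kappa> w j (i(j := k)))"

lemma past_weight_cong:
  assumes "\<And>m. m \<le> j \<Longrightarrow> i m = i' m"
  shows "past_weight \<kappa> w j i = past_weight \<kappa> w j i'"
  unfolding past_weight_def using assms by (intro prod.cong) auto

lemma future_weight_cong:
  assumes "\<And>m. j \<le> m \<Longrightarrow> m \<le> T \<Longrightarrow> i m = i' m"
  shows "future_weight T \<kappa> w j i = future_weight T \<kappa> w j i'"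
  unfolding future_weight_def using assms by (intro prod.cong) auto

lemma path_weight_split:
  assumes "j \<le> T"
  shows "(\<Prod>m<T. \<kappa> (i m) (i (Suc m))) * (\<Prod>m\<le>T. w m (i m)) =
    past_weight \<kappa> w j i * w j (i j) * future_weight T \<kappa> w j i"
proof -
  have steps: "(\<Prod>m<T. \<kappa> (i m) (i (Suc m))) =
      (\<Prod>m<j. \<kappa> (i m) (i (Suc m))) * (\<Prod>m=j..<T. \<kappa> (i m) (i (Suc m)))"
    using assms prod.atLeastLessThan_concat[of 0 j T "\<lambda>m. \<kappa> (i m) (i (Suc m))"]
    by (simp add: atLeast0LessThan)
  have "(\<Prod>m\<le>T. w m (i m)) = (\<Prod>m<j. w m (i m)) * (\<Prod>m=j..<Suc T. w m (i m))"
    using assms prod.atLeastLessThan_concat[of 0 j "Suc T" "\<lambda>m. w m (i m)"]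
    by (simp add: atLeast0LessThan lessThan_Suc_atMost del: prod.op_ivl_Suc)
  also have "(\<Prod>m=j..<Suc T. w m (i m)) = w j (i j) * (\<Prod>m=j..<T. w (Suc m) (i (Suc m)))"
    using assms by (simp add: prod.atLeast_Suc_lessThan prod.shift_bounds_Suc_ivl
        del: prod.op_ivl_Suc)
  finally show ?thesis
    unfolding past_weight_def future_weight_def steps prod.distrib by (simp add: algebra_simps)
qed

text \<open>The past weight depends only on the nodes up to \<open>j\<close>, the future weight only on those from \<open>j\<close>
  on. With the node at \<open>j\<close> fixed they have no free index in common, and the sum factorizes.\<close>

lemma chain_marginal:
  assumes "j \<le> T"
  shows "(\<Sum>i\<in>({0..T} - {j}) \<rightarrow>\<^sub>E UNIV.
      (\<Prod>m<T. \<kappa> ((i(j := k)) m) ((i(j := k)) (Suc m))) * (\<Prod>m\<le>T. w m ((i(j := k)) m))) =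
    forward_sum \<kappa> w j k * w j k * backward_sum T \<kappa> w j k"
proof -
  have modes: "{0..T} - {j} = {..<j} \<union> {j<..T}"
    using assms by auto
  have "(\<Sum>i\<in>({..<j} \<union> {j<..T}) \<rightarrow>\<^sub>E UNIV.
      past_weight \<kappa> w j (i(j := k)) * future_weight T \<kappa> w j (i(j := k))) =
    forward_sum \<kappa> w j k * backward_sum T \<kappa> w j k"
    unfolding forward_sum_def backward_sum_def
    by (rule sum_PiE_Un_mult) (auto intro!: past_weight_cong future_weight_cong)
  then show ?thesis
    unfolding modes path_weight_split[OF assms]
    by (simp add: mult.commute mult.left_commute flip: sum_distrib_left)
qed

lemma forward_sum_0: "forward_sum \<kappa> w 0 k = 1"
  by (simp add: forward_sum_def past_weight_def)

lemma forward_sum_Suc: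
  fixes \<kappa> :: "'n::finite \<Rightarrow> 'n \<Rightarrow> real"
  shows "forward_sum \<kappa> w (Suc j) k = (\<Sum>k'\<in>UNIV. \<kappa> k' k * (forward_sum \<kappa> w j k' * w j k'))"
proof -
  have "past_weight \<kappa> w (Suc j) (i(j := k', Suc j := k)) =
      past_weight \<kappa> w j (i(j := k')) * (w j k' * \<kappa> k' k)" for i k'
  proof -
    have "past_weight \<kappa> w (Suc j) (i(j := k', Suc j := k)) =
        past_weight \<kappa> w j (i(j := k', Suc j := k)) * (w j k' * \<kappa> k' k)"
      by (simp add: past_weight_def)
    also have "past_weight \<kappa> w j (i(j := k', Suc j := k)) = past_weight \<kappa> w j (i(j := k'))"
      by (rule past_weight_cong) auto
    finally show ?thesis .
  qed
  then show ?thesis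
    by (simp add: forward_sum_def lessThan_Suc sum_PiE_insert sum_distrib_left sum_distrib_right
        mult_ac)
qed

lemma backward_sum_end: "backward_sum T \<kappa> w T k = 1"
  by (simp add: backward_sum_def future_weight_def)

lemma backward_sum_step:
  fixes \<kappa> :: "'n::finite \<Rightarrow> 'n \<Rightarrow> real"
  assumes "j < T"
  shows "backward_sum T \<kappa> w j k =
    (\<Sum>k'\<in>UNIV. \<kappa> k k' * (backward_sum T \<kappa> w (Suc j) k' * w (Suc j) k'))"
proof -
  have modes: "{j<..T} = insert (Suc j) {Suc j<..T}"
    using assms by auto
  have "future_weight T \<kappa> w j (i(Suc j := k', j := k)) =
      \<kappa> k k' * w (Suc j) k' * future_weight T \<kappa> w (Suc j) (i(Suc j := k'))" for i k'
  proof -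
    have "future_weight T \<kappa> w j (i(Suc j := k', j := k)) =
        \<kappa> k k' * w (Suc j) k' * future_weight T \<kappa> w (Suc j) (i(Suc j := k', j := k))"
      using assms by (simp add: future_weight_def prod.atLeast_Suc_lessThan)
    also have "future_weight T \<kappa> w (Suc j) (i(Suc j := k', j := k)) =
        future_weight T \<kappa> w (Suc j) (i(Suc j := k'))"
      by (rule future_weight_cong) auto
    finally show ?thesis .
  qed
  then show ?thesis
    by (simp add: backward_sum_def modes sum_PiE_insert sum_distrib_left sum_distrib_right mult_ac)
qed

section \<open>The projections of the tensor\<close>

text \<open>Time \<open>0\<close> carries no vector \<open>u 0\<close>; treating it as \<open>1\<close> lets one formula cover all times.\<close>

definition node_weight ::
  "(nat \<Rightarrow> real ^ 'n ^ 'l) \<Rightarrow> (nat \<Rightarrow> real ^ 'n) \<Rightarrow> 'l \<Rightarrow> nat \<Rightarrow> 'n \<Rightarrow> real" where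
  "node_weight U u l j k = U j $ l $ k * (if j = 0 then 1 else u j $ k)"

lemma matrix_mult_diag_nth:
  fixes A :: "real ^ 'n::finite ^ 'l::finite"
  shows "(A ** diag v) $ l $ k = A $ l $ k * v $ k"
  by (simp add: matrix_matrix_mult_def diag_def if_distrib[of "\<lambda>x. _ * x"] cong: if_cong)

lemma U_tensor_eq_prod_node_weight:
  "U_tensor T U u l i = (\<Prod>m\<le>T. node_weight U u l m (i m))"
proof -
  have "{..T} = insert 0 {1..T}"
    by auto
  then have "(\<Prod>m\<le>T. node_weight U u l m (i m)) =
      node_weight U u l 0 (i 0) * (\<Prod>m=1..T. node_weight U u l m (i m))"
    by simp
  also have "(\<Prod>m=1..T. node_weight U u l m (i m)) =
      (\<Prod>m=1..T. U m $ l $ i m) * (\<Prod>m=1..T. u m $ i m)"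
    unfolding prod.distrib[symmetric] by (rule prod.cong) (auto simp: node_weight_def)
  finally show ?thesis
    by (simp add: U_tensor_def node_weight_def mult.assoc)
qed

lemma bimarginal_eq_forward_backward:
  fixes K :: "real ^ 'n::finite ^ 'n ^ 'l::finite"
  assumes "j \<le> T"
  shows "bimarginal T j (K_tensor T K \<odot>\<^sub>T U_tensor T U u) $ l $ k =
    forward_sum (\<lambda>i k. K $ l $ i $ k) (node_weight U u l) j k * node_weight U u l j k *
    backward_sum T (\<lambda>i k. K $ l $ i $ k) (node_weight U u l) j k"
  unfolding chain_marginal[OF assms, symmetric]
  by (simp add: bimarginal_def tensor_hadamard_def K_tensor_def U_tensor_eq_prod_node_weight
      del: fun_upd_apply)

lemma Psi_hat_eq_forward_sum:
  fixes K :: "real ^ 'n::finite ^ 'n ^ 'l::finite"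
  shows "Psi_hat K U u (Suc j) $ l $ k =
    forward_sum (\<lambda>i k. K $ l $ i $ k) (node_weight U u l) (Suc j) k"
proof (induction j arbitrary: k)
  case 0
  show ?case
    by (simp add: forward_sum_Suc forward_sum_0 S_op_hat_def node_weight_def)
next
  case (Suc j)
  then show ?case
    by (simp add: forward_sum_Suc[of _ _ "Suc j"] S_op_hat_def node_weight_def
        matrix_mult_diag_nth)
qed

lemma Psi_eq_backward_sum:
  fixes K :: "real ^ 'n::finite ^ 'n ^ 'l::finite"
  assumes "j < T"
  shows "Psi T K U u j $ l $ k =
    backward_sum T (\<lambda>i k. K $ l $ i $ k) (node_weight U u l) j k"
  using assms
proof (induction "T - j" arbitrary: j k)
  case 0
  then show ?case by simp
next
  case (Suc n)
  show ?case
  proof (cases "Suc j = T")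
    case True
    then show ?thesis
      by (subst Psi.simps)
        (auto simp: backward_sum_step backward_sum_end S_op_def node_weight_def
          matrix_mult_diag_nth)
  next
    case False
    then have "Suc j < T" "n = T - Suc j"
      using Suc.hyps(2) Suc.prems by auto
    with Suc.hyps(1)[of "Suc j"] Suc.prems show ?thesis
      by (subst Psi.simps)
        (simp add: backward_sum_step[of j] S_op_def node_weight_def matrix_mult_diag_nth)
  qed
qed

theorem theorem1:
  fixes T :: nat and \<epsilon> :: real
    and X :: "(real ^ 'd) set"
    and x :: "'n::finite \<Rightarrow> real ^ 'd"
    and f :: "'l::finite \<Rightarrow> real ^ 'd \<Rightarrow> real ^ 'd"
    and B :: "'l \<Rightarrow> real ^ 'd \<Rightarrow> real ^ 'd ^ 'd"
    and C :: "'l \<Rightarrow> 'n \<Rightarrow> 'n \<Rightarrow> ennreal"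
    and K :: "real ^ 'n ^ 'n ^ 'l"
    and U :: "nat \<Rightarrow> real ^ 'n ^ 'l"
    and u :: "nat \<Rightarrow> real ^ 'n"
  assumes "T \<ge> 1" and "\<epsilon> > 0"
    and "\<And>i. x i \<in> X"
    and "\<And>l. C1_bounded_deriv_on X (f l)"
    and "\<And>l. C1_bounded_deriv_on X (B l)"
    and C: "\<And>l i k. C l i k = transition_cost X (f l) (B l) (1 / real T) (x i) (x k)"
    and K: "\<And>l i k. K $ l $ i $ k = exp_neg (C l i k / ennreal \<epsilon>)"
  shows "(\<forall>j\<in>{1..<T}. bimarginal T j (K_tensor T K \<odot>\<^sub>T U_tensor T U u) =
            Psi T K U u j \<odot> Psi_hat K U u j \<odot> U j ** diag (u j)) \<and>
         bimarginal T 0 (K_tensor T K \<odot>\<^sub>T U_tensor T U u) = Psi T K U u 0 \<odot> U 0 \<and>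
         bimarginal T T (K_tensor T K \<odot>\<^sub>T U_tensor T U u) =
            Psi_hat K U u T \<odot> U T ** diag (u T)"
proof (intro conjI ballI)
  fix j
  assume j: "j \<in> {1..<T}"
  then obtain j' where "j = Suc j'"
    by (cases j) auto
  with j show "bimarginal T j (K_tensor T K \<odot>\<^sub>T U_tensor T U u) =
      Psi T K U u j \<odot> Psi_hat K U u j \<odot> U j ** diag (u j)"
    by (simp add: vec_eq_iff bimarginal_eq_forward_backward Psi_eq_backward_sum
        Psi_hat_eq_forward_sum node_weight_def matrix_mult_diag_nth)
next
  show "bimarginal T 0 (K_tensor T K \<odot>\<^sub>T U_tensor T U u) = Psi T K U u 0 \<odot> U 0"
    using \<open>T \<ge> 1\<close>
    by (simp add: vec_eq_iff bimarginal_eq_forward_backward Psi_eq_backward_sum forward_sum_0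
        node_weight_def)
next
  obtain t where "T = Suc t"
    using \<open>T \<ge> 1\<close> by (cases T) auto
  then show "bimarginal T T (K_tensor T K \<odot>\<^sub>T U_tensor T U u) = Psi_hat K U u T \<odot> U T ** diag (u T)"
    by (simp add: vec_eq_iff bimarginal_eq_forward_backward Psi_hat_eq_forward_sum
        backward_sum_end node_weight_def matrix_mult_diag_nth)
qed

end
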